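(* Let $r\ge1$, $\lambda>0$, $\Delta t>0$, and let $\bm u_{n+1}=G\bm u_n$ with $G=-A_+^{-1}A_-\in\mathbb{R}^{(r+1)\times(r+1)}$ be the DG scheme. Assume that the determinant of $A_+$ has the form $d=\alpha_0+\sum_{k=1}^N\lambda^k\Delta t^{2k}\alpha_k$ for some coefficients $\alpha_k\in\mathbb{R}$ independent of $\Delta t$ and $\lambda$ (with $\alpha_0\ne0$), and that $G$ has the form $$G=\frac1d\Bigl(G_0-\sum_{k=1}^N\lambda^k\Delta t^{2k}G_k\Bigr),$$ where the matrices $G_k$ are independent of $\Delta t$ and $\lambda$. Then the iteration $\bm u_{n+1}=G\bm u_n$ is equivalent to a general linear method $$\begin{bmatrix}Y\\ \bm y^{[n+1]}\end{bmatrix}=\begin{bmatrix}A&U\\ B&V\end{bmatrix}\begin{bmatrix}\Delta t^2f(Y)\\ \bm y^{[n]}\end{bmatrix},\qquad f(Y)=-\lambda Y,$$ with $\bm y^{[n]}\in\mathbb{R}^{2(r+1)}$ such that $(\bm y^{[n]})_{1:r+1}=\bm u_n$, $Y\in\mathbb{R}^{N(r+1)}$, and $$A=\begin{bmatrix}\frac{\alpha_1}{\alpha_0}I_{r+1}&\frac{\alpha_2}{\alpha_0}I_{r+1}&\cdots&\frac{\alpha_{N-1}}{\alpha_0}I_{r+1}&\frac{\alpha_N}{\alpha_0}I_{r+1}\\-I_{r+1}&0&\cdots&0&0\\0&-I_{r+1}&\cdots&0&0\\ \vdots&&\ddots&&\vdots\\0&0&\cdots&-I_{r+1}&0\end{bmatrix},\quad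 U=\begin{bmatrix}\frac1{\alpha_0}G_0&I_{r+1}\\0&0\\ \vdots&\vdots\\0&0\end{bmatrix},$$ $$B=\begin{bmatrix}\frac{\alpha_1}{\alpha_0}I_{r+1}&\frac{\alpha_2}{\alpha_0}I_{r+1}&\cdots&\frac{\alpha_{N-1}}{\alpha_0}I_{r+1}&\frac{\alpha_N}{\alpha_0}I_{r+1}\\ \frac1{\alpha_0}G_1&\frac1{\alpha_0}G_2&\cdots&\frac1{\alpha_0}G_{N-1}&\frac1{\alpha_0}G_N\end{bmatrix},\quad V=\begin{bmatrix}\frac1{\alpha_0}G_0&I_{r+1}\\0&0\end{bmatrix}.$$
   Context: $I_{r+1}$ is the $(r+1)\times(r+1)$ identity matrix; $N\ge1$ here is just the number of terms in the expansions. $A_\pm\in\mathbb{R}^{(r+1)\times(r+1)}$ are the local matrices of the one-step scheme $A_+\bm u_{n+1}+A_-\bm u_n=\bm0$ (the degree-$r$ time-DG discretization of $\ddot u+\lambda u=0$; only the assumed forms of $d$ and $G$ matter), with $A_+$ invertible, so $d\neq0$. $(\bm y)_{1:r+1}$ denotes the first $r+1$ components of $\bm y$. Meaning of equivalence: the vectors $\bm y^{[n]}$ are $\bm y^{[n]}=\bigl(\bm u_n,\,-\sum_{k=1}^N\frac{\lambda^k\Delta t^{2k}}{\alpha_0}G_k\bm u_n\bigr)$, and a sequence $(\bm u_n)$ satisfies $\bm u_{n+1}=G\bm u_n$ for all $n$ if and only if for every $n$ there is a stage vector $Y$ for which the general linear method step from $\bm y^{[n]}$ to $\bm y^{[n+1]}$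 holds. *)

theory Defs
  imports
    "Jordan_Normal_Form.Matrix"
    "Jordan_Normal_Form.Determinant"
    "Jordan_Normal_Form.Gauss_Jordan_Elimination"
begin

(* p x q array of m x m blocks; block indices start at 0. *)
definition block_mat :: "nat \<Rightarrow> nat \<Rightarrow> nat \<Rightarrow> (nat \<Rightarrow> nat \<Rightarrow> real mat) \<Rightarrow> real mat" where
  "block_mat m p q F =
     mat (p * m) (q * m) (\<lambda>(i, j). F (i div m) (j div m) $$ (i mod m, j mod m))"

lemma block_mat_carrier [simp]: "block_mat m p q F \<in> carrier_mat (p * m) (q * m)"
  by (simp add: block_mat_def)

(* "the" is harmless here: mat_inverse returns Some inverse for invertible Ap. *)
definition scheme_mat :: "real mat \<Rightarrow> real mat \<Rightarrow> real mat" where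
  "scheme_mat Ap Am = - the (mat_inverse Ap) * Am"

definition det_poly :: "nat \<Rightarrow> (nat \<Rightarrow> real) \<Rightarrow> real \<Rightarrow> real \<Rightarrow> real" where
  "det_poly N \<alpha> lam dt = \<alpha> 0 + (\<Sum>k = 1..N. lam ^ k * dt ^ (2 * k) * \<alpha> k)"

definition numerator_mat :: "nat \<Rightarrow> nat \<Rightarrow> (nat \<Rightarrow> real mat) \<Rightarrow> real \<Rightarrow> real \<Rightarrow> real mat" where
  "numerator_mat m N G lam dt =
     G 0 - finsum (module_mat TYPE(real) m m)
             (\<lambda>k. (lam ^ k * dt ^ (2 * k)) \<cdot>\<^sub>m G k) {1..N}"

(* m = r + 1. In glm_A and glm_B, column block j (from 0) carries the coefficient of index j + 1,
   since the stages are numbered from 1 and the coefficients of index 0 enter through glm_U, glm_V. *)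

definition glm_A :: "nat \<Rightarrow> nat \<Rightarrow> (nat \<Rightarrow> real) \<Rightarrow> real mat" where
  "glm_A m N \<alpha> = block_mat m N N (\<lambda>i j.
     if i = 0 then (\<alpha> (j + 1) / \<alpha> 0) \<cdot>\<^sub>m 1\<^sub>m m
     else if i = j + 1 then - 1\<^sub>m m
     else 0\<^sub>m m m)"

definition glm_U :: "nat \<Rightarrow> nat \<Rightarrow> (nat \<Rightarrow> real) \<Rightarrow> (nat \<Rightarrow> real mat) \<Rightarrow> real mat" where
  "glm_U m N \<alpha> G = block_mat m N 2 (\<lambda>i j.
     if i = 0 then (if j = 0 then (1 / \<alpha> 0) \<cdot>\<^sub>m G 0 else 1\<^sub>m m)
     else 0\<^sub>m m m)"

definition glm_B :: "nat \<Rightarrow> nat \<Rightarrow> (nat \<Rightarrow> real) \<Rightarrow> (nat \<Rightarrow> real mat) \<Rightarrow> real mat" where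
  "glm_B m N \<alpha> G = block_mat m 2 N (\<lambda>i j.
     if i = 0 then (\<alpha> (j + 1) / \<alpha> 0) \<cdot>\<^sub>m 1\<^sub>m m
     else (1 / \<alpha> 0) \<cdot>\<^sub>m G (j + 1))"

definition glm_V :: "nat \<Rightarrow> (nat \<Rightarrow> real) \<Rightarrow> (nat \<Rightarrow> real mat) \<Rightarrow> real mat" where
  "glm_V m \<alpha> G = block_mat m 2 2 (\<lambda>i j.
     if i = 0 then (if j = 0 then (1 / \<alpha> 0) \<cdot>\<^sub>m G 0 else 1\<^sub>m m)
     else 0\<^sub>m m m)"

definition glm_step ::
  "real mat \<Rightarrow> real mat \<Rightarrow> real mat \<Rightarrow> real mat \<Rightarrow> (real vec \<Rightarrow> real vec) \<Rightarrow> real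
     \<Rightarrow> real vec \<Rightarrow> real vec \<Rightarrow> real vec \<Rightarrow> bool" where
  "glm_step A U B V f dt Y y y' \<longleftrightarrow>
     Y @\<^sub>v y' = four_block_mat A U B V *\<^sub>v ((dt ^ 2 \<cdot>\<^sub>v f Y) @\<^sub>v y)"

definition glm_state ::
  "nat \<Rightarrow> nat \<Rightarrow> (nat \<Rightarrow> real) \<Rightarrow> (nat \<Rightarrow> real mat) \<Rightarrow> real \<Rightarrow> real \<Rightarrow> real vec \<Rightarrow> real vec" where
  "glm_state m N \<alpha> G lam dt u =
     u @\<^sub>v (- finsum_vec TYPE(real) m
              (\<lambda>k. (lam ^ k * dt ^ (2 * k) / \<alpha> 0) \<cdot>\<^sub>v (G k *\<^sub>v u)) {1..N})"

end

theory Submission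
  imports Defs
begin

text \<open>
  Put \<open>z = \<lambda> \<Delta>t\<^sup>2\<close>, so that \<open>\<Delta>t\<^sup>2 f(Y) = - z Y\<close>. The scheme \<open>u' = G u\<close> multiplied by its
  denominator \<open>d \<noteq> 0\<close> reads
  \<open>\<alpha>\<^sub>0 u' + (\<Sum>k. z\<^sup>k \<alpha>\<^sub>k u') = G\<^sub>0 u - (\<Sum>k. z\<^sup>k G\<^sub>k u)\<close>.
  The general linear method evaluates both sums without ever forming a power of \<open>z\<close> explicitly:

  \<^item> The subdiagonal blocks \<open>- I\<close> of \<open>A\<close> say that each stage is \<open>z\<close> times the preceding one. The
    first block rows of \<open>[A U]\<close> and \<open>[B V]\<close> coincide, hence the first stage is the new value \<open>u'\<close>.
    The stages are therefore forced to be \<open>u', z u', z\<^sup>2 u', \<dots>\<close>.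
  \<^item> With these stages, the second block row of \<open>[B V]\<close> outputs
    \<open>- (\<Sum>k. z\<^sup>k G\<^sub>k u') / \<alpha>\<^sub>0\<close>, which is precisely the second half of the state belonging to \<open>u'\<close>.
    It imposes no condition.
  \<^item> What remains is the first block row, \<open>u' = - (\<Sum>k. z\<^sup>k \<alpha>\<^sub>k u') / \<alpha>\<^sub>0 + G\<^sub>0 u / \<alpha>\<^sub>0 + w\<close>, where
    \<open>w\<close> is the second half of the old state. After multiplication by \<open>\<alpha>\<^sub>0\<close> it is the scheme above.

  Reading a step block by block (\<open>glm_step_iff_geometric_stages\<close>) yields the first observation; the other
  two make up \<open>ex_glm_step_iff\<close>, the equivalence of a single step with
  \<open>d u' = (G\<^sub>0 - (\<Sum>k. z\<^sup>k G\<^sub>k)) u\<close>. Since \<open>d\<close> is the determinant of the invertible matrix \<open>A\<^sub>+\<close>, it is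
  nonzero, and dividing by it returns to \<open>u' = G u\<close>.
\<close>

section \<open>Vectors and matrices read block by block\<close>

definition vec_block :: "nat \<Rightarrow> 'a vec \<Rightarrow> nat \<Rightarrow> 'a vec" where
  "vec_block m x j = vec m (\<lambda>c. x $ (j * m + c))"

lemma vec_block_carrier [simp]: "vec_block m x j \<in> carrier_vec m"
  by (simp add: vec_block_def)

lemma index_vec_block [simp]: "c < m \<Longrightarrow> vec_block m x j $ c = x $ (j * m + c)"
  by (simp add: vec_block_def)

lemma dim_vec_block [simp]: "dim_vec (vec_block m x j) = m"
  by (simp add: vec_block_def)

lemma block_index_less:
  fixes m :: nat
  assumes "j < q" and "c < m"
  shows "j * m + c < q * m"
proof -
  have "j * m + c < Suc j * m" using assms by simp
  also have "\<dots> \<le> q * m" using assms by (intro mult_le_mono1) simp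
  finally show ?thesis .
qed

lemma vec_block_smult:
  fixes a :: "'a :: comm_semiring_0"
  assumes "x \<in> carrier_vec (q * m)" and "j < q"
  shows "vec_block m (a \<cdot>\<^sub>v x) j = a \<cdot>\<^sub>v vec_block m x j"
  using assms block_index_less[OF assms(2)] by (intro eq_vecI) auto

lemma vec_block_add:
  fixes x y :: "'a :: monoid_add vec"
  assumes "x \<in> carrier_vec (q * m)" "y \<in> carrier_vec (q * m)" and "j < q"
  shows "vec_block m (x + y) j = vec_block m x j + vec_block m y j"
  using assms block_index_less[OF assms(3)] by (intro eq_vecI) auto

lemma vec_block_append:
  assumes "u \<in> carrier_vec m" and "w \<in> carrier_vec m"
  shows "vec_block m (u @\<^sub>v w) 0 = u" and "vec_block m (u @\<^sub>v w) (Suc 0) = w"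
  using assms by (auto intro!: eq_vecI)

lemma eq_vec_iff_vec_blocks:
  assumes x: "x \<in> carrier_vec (q * m)" and y: "y \<in> carrier_vec (q * m)"
  shows "x = y \<longleftrightarrow> (\<forall>i<q. vec_block m x i = vec_block m y i)"
proof
  assume blocks: "\<forall>i<q. vec_block m x i = vec_block m y i"
  show "x = y"
  proof (rule eq_vecI)
    fix k assume "k < dim_vec y"
    hence k: "k < q * m" using y by simp
    hence m: "m > 0" by (cases m) auto
    have i: "k div m < q" using k by (simp add: less_mult_imp_div_less)
    have "vec_block m x (k div m) $ (k mod m) = vec_block m y (k div m) $ (k mod m)"
      using blocks i by simp
    thus "x $ k = y $ k" using m by simp
  qed (use x y in simp)
qed simp

lemma sum_lessThan_mult:
  fixes f :: "nat \<Rightarrow> 'a :: comm_monoid_add"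
  shows "(\<Sum>k<q * m. f k) = (\<Sum>j<q. \<Sum>c<m. f (j * m + c))"
proof (induction q)
  case (Suc q)
  have "(\<Sum>k<Suc q * m. f k) = (\<Sum>k<q * m. f k) + (\<Sum>k=q * m..<q * m + m. f k)"
    by (simp add: lessThan_atLeast0 sum.atLeastLessThan_concat add.commute)
  also have "(\<Sum>k=q * m..<q * m + m. f k) = (\<Sum>c<m. f (q * m + c))"
    using sum.shift_bounds_nat_ivl[of f 0 "q * m" m]
    by (simp add: lessThan_atLeast0 add.commute)
  finally show ?case using Suc by simp
qed simp

text \<open>
  The usual rule for multiplying a block matrix by a block vector. It is stated for entries
  because the block equations are compared entrywise with the scalar expansions of \<open>d\<close> and \<open>G\<close>.
\<close>
lemma index_vec_block_block_mat_mult: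
  assumes F: "\<And>i j. i < p \<Longrightarrow> j < q \<Longrightarrow> F i j \<in> carrier_mat m m"
    and x: "x \<in> carrier_vec (q * m)" and i: "i < p" and c: "c < m"
  shows "vec_block m (block_mat m p q F *\<^sub>v x) i $ c = (\<Sum>j<q. (F i j *\<^sub>v vec_block m x j) $ c)"
proof -
  have "vec_block m (block_mat m p q F *\<^sub>v x) i $ c
      = (\<Sum>k<q * m. F i (k div m) $$ (c, k mod m) * x $ k)"
    using i c x block_index_less[OF i c]
    by (auto simp: block_mat_def scalar_prod_def lessThan_atLeast0 intro!: sum.cong)
  also have "\<dots> = (\<Sum>j<q. \<Sum>e<m. F i j $$ (c, e) * x $ (j * m + e))"
    by (auto simp: sum_lessThan_mult intro!: sum.cong)
  also have "\<dots> = (\<Sum>j<q. (F i j *\<^sub>v vec_block m x j) $ c)"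
  proof (rule sum.cong[OF refl])
    fix j assume "j \<in> {..<q}"
    hence "F i j \<in> carrier_mat m m" using F i by simp
    thus "(\<Sum>e<m. F i j $$ (c, e) * x $ (j * m + e)) = (F i j *\<^sub>v vec_block m x j) $ c"
      using c by (auto simp: scalar_prod_def lessThan_atLeast0 intro!: sum.cong)
  qed
  finally show ?thesis .
qed

lemma zero_mat_mult_vec [simp]:
  fixes v :: "'a :: semiring_0 vec"
  shows "v \<in> carrier_vec n \<Longrightarrow> 0\<^sub>m m n *\<^sub>v v = 0\<^sub>v m"
  by (intro eq_vecI) auto

lemma smult_mat_mult_vec:
  fixes M :: "'a :: comm_semiring_0 mat"
  assumes "M \<in> carrier_mat k n" and "v \<in> carrier_vec n"
  shows "(a \<cdot>\<^sub>m M) *\<^sub>v v = a \<cdot>\<^sub>v (M *\<^sub>v v)"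
  using assms by (intro eq_vecI) auto

section \<open>The expansions in powers of \<open>z\<close>\<close>

text \<open>
  Scheme and state are written with \<open>\<lambda>\<^sup>k \<Delta>t\<^sup>2\<^sup>k\<close>, whereas a step of the method multiplies by \<open>z\<close>.
\<close>
lemma pow_step:
  fixes lam dt :: "'a :: comm_semiring_1"
  shows "lam ^ k * dt ^ (2 * k) = (lam * dt\<^sup>2) ^ k"
  by (simp add: power_mult_distrib power_mult)

lemma numerator_mat_carrier:
  assumes G: "\<And>k. k \<le> N \<Longrightarrow> G k \<in> carrier_mat m m"
  shows "numerator_mat m N G lam dt \<in> carrier_mat m m"
proof -
  interpret M: abelian_group "module_mat TYPE(real) m m" by (rule abelian_group_mat)
  have "finsum (module_mat TYPE(real) m m) (\<lambda>k. (lam ^ k * dt ^ (2 * k)) \<cdot>\<^sub>m G k) {1..N}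
      \<in> carrier (module_mat TYPE(real) m m)"
    using G by (intro M.finsum_closed) (auto simp: module_mat_simps)
  thus ?thesis using G[of 0] by (auto simp: numerator_mat_def module_mat_simps)
qed

lemma numerator_mat_mult_vec:
  assumes G: "\<And>k. k \<le> N \<Longrightarrow> G k \<in> carrier_mat m m" and v: "v \<in> carrier_vec m" and c: "c < m"
  shows "(numerator_mat m N G lam dt *\<^sub>v v) $ c
      = (G 0 *\<^sub>v v) $ c - (\<Sum>k=1..N. (lam * dt\<^sup>2) ^ k * (G k *\<^sub>v v) $ c)"
proof -
  interpret M: abelian_group "module_mat TYPE(real) m m" by (rule abelian_group_mat)
  let ?S = "\<lambda>K. finsum (module_mat TYPE(real) m m) (\<lambda>k. (lam ^ k * dt ^ (2 * k)) \<cdot>\<^sub>m G k) K"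
  \<comment> \<open>Over subsets of the range, so that adding one index at a time keeps all sizes right.\<close>
  have S: "?S K \<in> carrier_mat m m
      \<and> (?S K *\<^sub>v v) $ c = (\<Sum>k\<in>K. (lam * dt\<^sup>2) ^ k * (G k *\<^sub>v v) $ c)"
    if "finite K" and "K \<subseteq> {1..N}" for K
    using that
  proof (induction K rule: finite_induct)
    case empty
    thus ?case using c v by (simp add: module_mat_simps)
  next
    case (insert k K)
    have Gk: "G k \<in> carrier_mat m m" using insert.prems G by auto
    have IH: "?S K \<in> carrier_mat m m"
      "(?S K *\<^sub>v v) $ c = (\<Sum>k\<in>K. (lam * dt\<^sup>2) ^ k * (G k *\<^sub>v v) $ c)"
      using insert by auto
    have "?S (insert k K) = (lam ^ k * dt ^ (2 * k)) \<cdot>\<^sub>m G k + ?S K"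
      using insert.hyps insert.prems G
      by (subst M.finsum_insert) (auto simp: module_mat_simps Pi_def)
    moreover have "((lam ^ k * dt ^ (2 * k)) \<cdot>\<^sub>m G k + ?S K) *\<^sub>v v
        = (lam * dt\<^sup>2) ^ k \<cdot>\<^sub>v (G k *\<^sub>v v) + ?S K *\<^sub>v v"
      using Gk IH(1) v by (subst add_mult_distrib_mat_vec) (auto simp: smult_mat_mult_vec pow_step)
    ultimately show ?case
      using insert.hyps Gk IH c v by (auto simp del: index_mult_mat_vec)
  qed
  have K: "?S {1..N} \<in> carrier_mat m m" using S by simp
  have G0: "G 0 \<in> carrier_mat m m" using G by simp
  show "(numerator_mat m N G lam dt *\<^sub>v v) $ c
      = (G 0 *\<^sub>v v) $ c - (\<Sum>k=1..N. (lam * dt\<^sup>2) ^ k * (G k *\<^sub>v v) $ c)"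
  proof -
    have "(numerator_mat m N G lam dt *\<^sub>v v) $ c = (G 0 *\<^sub>v v) $ c - (?S {1..N} *\<^sub>v v) $ c"
      unfolding numerator_mat_def using K G0 v c
      by (subst minus_mult_distrib_mat_vec) (auto simp del: index_mult_mat_vec)
    thus ?thesis using S by simp
  qed
qed

definition history_part ::
  "nat \<Rightarrow> nat \<Rightarrow> (nat \<Rightarrow> real) \<Rightarrow> (nat \<Rightarrow> real mat) \<Rightarrow> real \<Rightarrow> real vec \<Rightarrow> real vec" where
  "history_part m N \<alpha> G z u
     = vec m (\<lambda>c. - (\<Sum>k=1..N. z ^ k / \<alpha> 0 * (G k *\<^sub>v u) $ c))"

lemma glm_state_eq:
  assumes G: "\<And>k. k \<le> N \<Longrightarrow> G k \<in> carrier_mat m m" and u: "u \<in> carrier_vec m"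
  shows "glm_state m N \<alpha> G lam dt u = u @\<^sub>v history_part m N \<alpha> G (lam * dt\<^sup>2) u"
proof -
  let ?f = "\<lambda>k. ((lam * dt\<^sup>2) ^ k / \<alpha> 0) \<cdot>\<^sub>v (G k *\<^sub>v u)"
  have dimG: "dim_row (G k) = m" if "k \<le> N" for k using G[OF that] by simp
  have f: "?f \<in> {1..N} \<rightarrow> carrier_vec m" using mult_mat_vec_carrier[OF G u] by auto
  have "- finsum_vec TYPE(real) m ?f {1..N} = history_part m N \<alpha> G (lam * dt\<^sup>2) u"
  proof (rule eq_vecI)
    fix c assume "c < dim_vec (history_part m N \<alpha> G (lam * dt\<^sup>2) u)"
    hence c: "c < m" by (simp add: history_part_def)
    have "finsum_vec TYPE(real) m ?f {1..N} $ c = (\<Sum>k=1..N. ?f k $ c)"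
      using c f by (intro index_finsum_vec) auto
    also have "\<dots> = (\<Sum>k=1..N. (lam * dt\<^sup>2) ^ k / \<alpha> 0 * (G k *\<^sub>v u) $ c)"
      using c dimG by (intro sum.cong) (auto simp del: index_mult_mat_vec)
    finally show "(- finsum_vec TYPE(real) m ?f {1..N}) $ c
        = history_part m N \<alpha> G (lam * dt\<^sup>2) u $ c"
      using c finsum_vec_closed[OF f]
      by (simp add: history_part_def del: index_mult_mat_vec One_nat_def)
  qed (use finsum_vec_closed[OF f] in \<open>simp add: history_part_def\<close>)
  thus ?thesis by (simp add: glm_state_def pow_step)
qed

section \<open>One step of the general linear method\<close>

definition geometric_stages :: "nat \<Rightarrow> nat \<Rightarrow> real \<Rightarrow> real vec \<Rightarrow> real vec" where
  "geometric_stages m N z v = vec (N * m) (\<lambda>k. z ^ (k div m) * v $ (k mod m))"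

lemma vec_block_geometric_stages:
  assumes "v \<in> carrier_vec m" and "i < N"
  shows "vec_block m (geometric_stages m N z v) i = z ^ i \<cdot>\<^sub>v v"
  using assms block_index_less[OF assms(2)]
  by (intro eq_vecI) (auto simp: geometric_stages_def)

lemma eq_geometric_stages_iff:
  assumes Y: "Y \<in> carrier_vec (N * m)" and v: "v \<in> carrier_vec m" and N: "N \<ge> 1"
  shows "Y = geometric_stages m N z v \<longleftrightarrow>
    vec_block m Y 0 = v \<and> (\<forall>i. Suc i < N \<longrightarrow> vec_block m Y (Suc i) = z \<cdot>\<^sub>v vec_block m Y i)"
    (is "_ \<longleftrightarrow> ?R")
proof
  assume "Y = geometric_stages m N z v"
  thus ?R using v N by (auto simp: vec_block_geometric_stages smult_smult_assoc)
next
  assume R: ?R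
  have "vec_block m Y i = z ^ i \<cdot>\<^sub>v v" if "i < N" for i
    using that
  proof (induction i)
    case (Suc i)
    thus ?case using R by (simp add: smult_smult_assoc)
  qed (use R in simp)
  thus "Y = geometric_stages m N z v"
    using v Y by (subst eq_vec_iff_vec_blocks[of _ N m])
      (auto simp: vec_block_geometric_stages, simp add: geometric_stages_def)
qed

text \<open>
  The first block row shared by \<open>[A U]\<close> and \<open>[B V]\<close>, applied to \<open>- z Y\<close> and the state \<open>(u, w)\<close>.
  It serves both as first stage and as new value of \<open>u\<close>.
\<close>
definition block_update ::
  "nat \<Rightarrow> nat \<Rightarrow> (nat \<Rightarrow> real) \<Rightarrow> (nat \<Rightarrow> real mat) \<Rightarrow> real \<Rightarrow> real vec \<Rightarrow> real vec \<Rightarrow> real vec \<Rightarrow> real vec"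
  where
  "block_update m N \<alpha> G z Y u w = vec m (\<lambda>c.
     - z * (\<Sum>j<N. \<alpha> (j + 1) / \<alpha> 0 * vec_block m Y j $ c) + ((G 0 *\<^sub>v u) $ c / \<alpha> 0 + w $ c))"

context
  fixes m N :: nat and \<alpha> :: "nat \<Rightarrow> real" and G :: "nat \<Rightarrow> real mat"
  assumes G: "\<And>k. k \<le> N \<Longrightarrow> G k \<in> carrier_mat m m"
begin

lemma vec_block_glm_A_mult:
  assumes x: "x \<in> carrier_vec (N * m)"
  shows "i < N \<Longrightarrow> vec_block m (glm_A m N \<alpha> *\<^sub>v x) i =
    (if i = 0 then vec m (\<lambda>c. \<Sum>j<N. \<alpha> (j + 1) / \<alpha> 0 * vec_block m x j $ c)
     else - vec_block m x (i - 1))"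
proof -
  assume i: "i < N"
  note blk = index_vec_block_block_mat_mult[OF _ x i,
      where F = "\<lambda>i j. if i = 0 then (\<alpha> (j + 1) / \<alpha> 0) \<cdot>\<^sub>m 1\<^sub>m m else if i = j + 1 then - 1\<^sub>m m else 0\<^sub>m m m"]
  show ?thesis
  proof (cases i)
    case 0
    show ?thesis unfolding glm_A_def
      by (intro eq_vecI, subst blk)
        (auto simp: 0 smult_mat_mult_vec[of _ m m] simp del: index_mult_mat_vec index_vec_block)
  next
    case (Suc l)
    have "(\<Sum>j<N. ((if l = j then - 1\<^sub>m m else 0\<^sub>m m m) *\<^sub>v vec_block m x j) $ c)
        = (\<Sum>j<N. if j = l then - (vec_block m x l $ c) else 0)" if "c < m" for c
      using that by (intro sum.cong) (auto simp del: index_mult_mat_vec)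
    thus ?thesis unfolding glm_A_def using i
      by (intro eq_vecI, subst blk)
        (auto simp: Suc simp del: index_mult_mat_vec index_vec_block)
  qed
qed

lemma vec_block_glm_B_mult:
  assumes x: "x \<in> carrier_vec (N * m)"
  shows "vec_block m (glm_B m N \<alpha> G *\<^sub>v x) 0
      = vec m (\<lambda>c. \<Sum>j<N. \<alpha> (j + 1) / \<alpha> 0 * vec_block m x j $ c)"
    and "vec_block m (glm_B m N \<alpha> G *\<^sub>v x) (Suc 0)
      = vec m (\<lambda>c. \<Sum>j<N. (G (j + 1) *\<^sub>v vec_block m x j) $ c / \<alpha> 0)"
proof -
  have G': "G (Suc j) \<in> carrier_mat m m" "dim_row (G (Suc j)) = m" if "j < N" for j
    using G[of "Suc j"] that by auto
  note blk = index_vec_block_block_mat_mult[OF _ x,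
      where p = 2 and F = "\<lambda>i j. if i = 0 then (\<alpha> (j + 1) / \<alpha> 0) \<cdot>\<^sub>m 1\<^sub>m m else (1 / \<alpha> 0) \<cdot>\<^sub>m G (j + 1)"]
  show "vec_block m (glm_B m N \<alpha> G *\<^sub>v x) 0
      = vec m (\<lambda>c. \<Sum>j<N. \<alpha> (j + 1) / \<alpha> 0 * vec_block m x j $ c)"
    unfolding glm_B_def using G'
    by (intro eq_vecI, subst blk)
      (auto simp: smult_mat_mult_vec[of _ m m] simp del: index_mult_mat_vec index_vec_block)
  show "vec_block m (glm_B m N \<alpha> G *\<^sub>v x) (Suc 0)
      = vec m (\<lambda>c. \<Sum>j<N. (G (j + 1) *\<^sub>v vec_block m x j) $ c / \<alpha> 0)"
    unfolding glm_B_def using G'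
    by (intro eq_vecI, subst blk)
      (auto simp: smult_mat_mult_vec[of _ m m] simp del: index_mult_mat_vec index_vec_block)
qed

lemma vec_block_glm_UV_mult:
  assumes u: "u \<in> carrier_vec m" and w: "w \<in> carrier_vec m"
  shows "i < N \<Longrightarrow> vec_block m (glm_U m N \<alpha> G *\<^sub>v (u @\<^sub>v w)) i
      = (if i = 0 then vec m (\<lambda>c. (G 0 *\<^sub>v u) $ c / \<alpha> 0 + w $ c) else 0\<^sub>v m)"
    and "i < 2 \<Longrightarrow> vec_block m (glm_V m \<alpha> G *\<^sub>v (u @\<^sub>v w)) i
      = (if i = 0 then vec m (\<lambda>c. (G 0 *\<^sub>v u) $ c / \<alpha> 0 + w $ c) else 0\<^sub>v m)"
proof -
  have uw: "u @\<^sub>v w \<in> carrier_vec (2 * m)" using u w by (simp add: mult_2)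
  have G0: "G 0 \<in> carrier_mat m m" "dim_row (G 0) = m" using G[of 0] by auto
  have gen: "vec_block m (block_mat m p 2 (\<lambda>i j.
       if i = 0 then (if j = 0 then (1 / \<alpha> 0) \<cdot>\<^sub>m G 0 else 1\<^sub>m m) else 0\<^sub>m m m) *\<^sub>v (u @\<^sub>v w)) i
     = (if i = 0 then vec m (\<lambda>c. (G 0 *\<^sub>v u) $ c / \<alpha> 0 + w $ c) else 0\<^sub>v m)" if i: "i < p" for p
    using G0 u w
    by (intro eq_vecI, subst index_vec_block_block_mat_mult[OF _ uw i])
      (auto simp: numeral_2_eq_2 vec_block_append smult_mat_mult_vec[of _ m m]
        simp del: index_mult_mat_vec index_vec_block split: if_splits)
  show "i < N \<Longrightarrow> vec_block m (glm_U m N \<alpha> G *\<^sub>v (u @\<^sub>v w)) i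
      = (if i = 0 then vec m (\<lambda>c. (G 0 *\<^sub>v u) $ c / \<alpha> 0 + w $ c) else 0\<^sub>v m)"
    unfolding glm_U_def by (rule gen)
  show "i < 2 \<Longrightarrow> vec_block m (glm_V m \<alpha> G *\<^sub>v (u @\<^sub>v w)) i
      = (if i = 0 then vec m (\<lambda>c. (G 0 *\<^sub>v u) $ c / \<alpha> 0 + w $ c) else 0\<^sub>v m)"
    unfolding glm_V_def by (rule gen)
qed

text \<open>
  The stage equations for the rows below the first give the recursion with ratio \<open>z\<close>, and the two
  first rows identify the starting value of this recursion with \<open>u'\<close>. Thus the stage vector is
  determined by \<open>u'\<close>, and only the two output equations are left.
\<close>
lemma glm_step_iff_geometric_stages:
  fixes lam dt :: real
  assumes N: "N \<ge> 1" and Y: "Y \<in> carrier_vec (N * m)"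
    and u: "u \<in> carrier_vec m" and w: "w \<in> carrier_vec m"
    and u': "u' \<in> carrier_vec m" and w': "w' \<in> carrier_vec m"
  defines "z \<equiv> lam * dt\<^sup>2"
  shows "glm_step (glm_A m N \<alpha>) (glm_U m N \<alpha> G) (glm_B m N \<alpha> G) (glm_V m \<alpha> G)
      (\<lambda>Z. - lam \<cdot>\<^sub>v Z) dt Y (u @\<^sub>v w) (u' @\<^sub>v w') \<longleftrightarrow>
    Y = geometric_stages m N z u' \<and> u' = block_update m N \<alpha> G z Y u w
    \<and> w' = vec m (\<lambda>c. - z * (\<Sum>j<N. (G (j + 1) *\<^sub>v vec_block m Y j) $ c / \<alpha> 0))"
    (is "_ \<longleftrightarrow> ?R")
proof -
  define x where "x = dt\<^sup>2 \<cdot>\<^sub>v (- lam \<cdot>\<^sub>v Y)"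
  have x: "x \<in> carrier_vec (N * m)" using Y by (simp add: x_def)
  have xY: "vec_block m x j = - z \<cdot>\<^sub>v vec_block m Y j" if "j < N" for j
    using Y that unfolding x_def z_def
    by (simp add: vec_block_smult[of _ N] smult_smult_assoc mult.commute)
  have uw: "u @\<^sub>v w \<in> carrier_vec (2 * m)" "u' @\<^sub>v w' \<in> carrier_vec (2 * m)"
    using u w u' w' by (simp_all add: mult_2)
  have A: "glm_A m N \<alpha> \<in> carrier_mat (N * m) (N * m)" by (simp add: glm_A_def)
  have U: "glm_U m N \<alpha> G \<in> carrier_mat (N * m) (2 * m)" by (simp add: glm_U_def)
  have B: "glm_B m N \<alpha> G \<in> carrier_mat (2 * m) (N * m)" by (simp add: glm_B_def)
  have V: "glm_V m \<alpha> G \<in> carrier_mat (2 * m) (2 * m)" by (simp add: glm_V_def)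
  note carr = A U B V x uw Y
  let ?S = "glm_A m N \<alpha> *\<^sub>v x + glm_U m N \<alpha> G *\<^sub>v (u @\<^sub>v w)"
  let ?T = "glm_B m N \<alpha> G *\<^sub>v x + glm_V m \<alpha> G *\<^sub>v (u @\<^sub>v w)"
  have S: "?S \<in> carrier_vec (N * m)" and T: "?T \<in> carrier_vec (2 * m)"
    using carr by auto
  have Gdim: "dim_row (G (Suc j)) = m" "G (Suc j) \<in> carrier_mat m m" if "j < N" for j
    using G[of "Suc j"] that by auto
  have alpha_sum: "(\<Sum>j<N. \<alpha> (j + 1) / \<alpha> 0 * vec_block m x j $ c)
      = - z * (\<Sum>j<N. \<alpha> (j + 1) / \<alpha> 0 * vec_block m Y j $ c)" if "c < m" for c
    using that unfolding sum_distrib_left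
    by (intro sum.cong) (auto simp: xY simp del: index_vec_block)
  have G_sum: "(\<Sum>j<N. (G (j + 1) *\<^sub>v vec_block m x j) $ c / \<alpha> 0)
      = - z * (\<Sum>j<N. (G (j + 1) *\<^sub>v vec_block m Y j) $ c / \<alpha> 0)" if "c < m" for c
    using that Gdim unfolding sum_distrib_left
    by (intro sum.cong)
      (auto simp: xY mult_mat_vec[of _ m m] simp del: index_vec_block index_mult_mat_vec)
  have S0: "vec_block m ?S 0 = block_update m N \<alpha> G z Y u w"
    using carr N alpha_sum
    by (subst vec_block_add[of _ N])
      (auto intro!: eq_vecI simp: vec_block_glm_A_mult vec_block_glm_UV_mult[OF u w] block_update_def
        simp del: index_vec_block index_mult_mat_vec)
  have SS: "vec_block m ?S (Suc i) = z \<cdot>\<^sub>v vec_block m Y i" if "Suc i < N" for i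
    using carr that
    by (subst vec_block_add[of _ N])
      (auto intro!: eq_vecI simp: vec_block_glm_A_mult vec_block_glm_UV_mult[OF u w] xY
        simp del: index_vec_block index_mult_mat_vec)
  have T0: "vec_block m ?T 0 = block_update m N \<alpha> G z Y u w"
    using carr alpha_sum
    by (subst vec_block_add[of _ 2])
      (auto intro!: eq_vecI simp: vec_block_glm_B_mult vec_block_glm_UV_mult[OF u w] block_update_def
        simp del: index_vec_block index_mult_mat_vec)
  have T1: "vec_block m ?T (Suc 0) = vec m (\<lambda>c. - z * (\<Sum>j<N. (G (j + 1) *\<^sub>v vec_block m Y j) $ c / \<alpha> 0))"
    using carr G_sum
    by (subst vec_block_add[of _ 2])
      (auto intro!: eq_vecI simp: vec_block_glm_B_mult vec_block_glm_UV_mult[OF u w]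
        simp del: index_vec_block index_mult_mat_vec)
  have "glm_step (glm_A m N \<alpha>) (glm_U m N \<alpha> G) (glm_B m N \<alpha> G) (glm_V m \<alpha> G)
      (\<lambda>Z. - lam \<cdot>\<^sub>v Z) dt Y (u @\<^sub>v w) (u' @\<^sub>v w') \<longleftrightarrow> Y = ?S \<and> u' @\<^sub>v w' = ?T"
    unfolding glm_step_def x_def[symmetric]
    by (simp only: four_block_mat_mult_vec[OF A U B V x uw(1)] append_vec_eq[OF Y S])
  also have "u' @\<^sub>v w' = ?T \<longleftrightarrow> u' = block_update m N \<alpha> G z Y u w
      \<and> w' = vec m (\<lambda>c. - z * (\<Sum>j<N. (G (j + 1) *\<^sub>v vec_block m Y j) $ c / \<alpha> 0))"
    unfolding eq_vec_iff_vec_blocks[OF uw(2) T]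
    by (simp add: numeral_2_eq_2 All_less_Suc vec_block_append[OF u' w'] T0 T1 conj_commute
        del: One_nat_def)
  also have "Y = ?S \<longleftrightarrow> vec_block m Y 0 = block_update m N \<alpha> G z Y u w
      \<and> (\<forall>i. Suc i < N \<longrightarrow> vec_block m Y (Suc i) = z \<cdot>\<^sub>v vec_block m Y i)"
    (is "_ \<longleftrightarrow> ?Q")
  proof
    assume "Y = ?S"
    hence "\<forall>i<N. vec_block m Y i = vec_block m ?S i" by simp
    thus ?Q using N S0 SS by (metis One_nat_def Suc_le_lessD)
  next
    assume Q: ?Q
    have "vec_block m Y i = vec_block m ?S i" if "i < N" for i
      using that Q S0 SS by (cases i) auto
    thus "Y = ?S" unfolding eq_vec_iff_vec_blocks[OF Y S] by blast
  qed
  finally show ?thesis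
    using eq_geometric_stages_iff[OF Y u' N, of z] by auto
qed

text \<open>
  Since the stages are \<open>z\<^sup>j u'\<close>, the output equation for the second half of the state holds identically:
  its \<open>j\<close>-th summand \<open>- z G\<^sub>j\<^sub>+\<^sub>1 (z\<^sup>j u') / \<alpha>\<^sub>0\<close> is the term of index \<open>j + 1\<close> in the state belonging to \<open>u'\<close>.
  The first output equation is implicit in \<open>u'\<close>, and collecting the multiples of \<open>u'\<close> produces the
  polynomial \<open>d\<close>.
\<close>
lemma ex_glm_step_iff:
  assumes N: "N \<ge> 1" and \<alpha>0: "\<alpha> 0 \<noteq> 0"
    and u: "u \<in> carrier_vec m" and u': "u' \<in> carrier_vec m"
  shows "(\<exists>Y \<in> carrier_vec (N * m).
      glm_step (glm_A m N \<alpha>) (glm_U m N \<alpha> G) (glm_B m N \<alpha> G) (glm_V m \<alpha> G)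
        (\<lambda>Z. - lam \<cdot>\<^sub>v Z) dt Y (glm_state m N \<alpha> G lam dt u) (glm_state m N \<alpha> G lam dt u'))
    \<longleftrightarrow> det_poly N \<alpha> lam dt \<cdot>\<^sub>v u' = numerator_mat m N G lam dt *\<^sub>v u"
proof -
  define z where "z = lam * dt\<^sup>2"
  \<comment> \<open>The only stage vector that a step ending in \<open>u'\<close> can have.\<close>
  define Y where "Y = geometric_stages m N z u'"
  have Y: "Y \<in> carrier_vec (N * m)" by (simp add: Y_def geometric_stages_def)
  have Yj: "vec_block m Y j = z ^ j \<cdot>\<^sub>v u'" if "j < N" for j
    unfolding Y_def by (rule vec_block_geometric_stages[OF u' that])
  have h: "history_part m N \<alpha> G z v \<in> carrier_vec m" for v
    by (simp add: history_part_def)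
  have Gdim: "dim_row (G (Suc j)) = m" "G (Suc j) \<in> carrier_mat m m" if "j < N" for j
    using G[of "Suc j"] that by auto
  have shift: "(\<Sum>k=1..N. f k) = (\<Sum>j<N. f (Suc j))" for f :: "nat \<Rightarrow> real"
    by (simp add: sum.atLeast1_atMost_eq)
  have history: "history_part m N \<alpha> G z u'
      = vec m (\<lambda>c. - z * (\<Sum>j<N. (G (j + 1) *\<^sub>v vec_block m Y j) $ c / \<alpha> 0))"
    using u' Gdim unfolding history_part_def shift
    by (intro eq_vecI)
      (auto simp: Yj mult_mat_vec[of _ m m] sum_distrib_left sum_negf
        simp del: index_vec_block index_mult_mat_vec intro!: sum.cong)
  have state: "glm_state m N \<alpha> G lam dt v = v @\<^sub>v history_part m N \<alpha> G z v"
    if "v \<in> carrier_vec m" for v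
    unfolding z_def using G that by (rule glm_state_eq)
  have d: "det_poly N \<alpha> lam dt = \<alpha> 0 + (\<Sum>j<N. z ^ Suc j * \<alpha> (Suc j))"
    unfolding det_poly_def shift z_def pow_step ..
  have comp: "u' $ c = block_update m N \<alpha> G z Y u (history_part m N \<alpha> G z u) $ c \<longleftrightarrow>
      det_poly N \<alpha> lam dt * u' $ c = (numerator_mat m N G lam dt *\<^sub>v u) $ c" if c: "c < m" for c
  proof -
    let ?D = "\<Sum>j<N. z ^ Suc j * \<alpha> (Suc j)"
    let ?H = "\<Sum>k=1..N. z ^ k * (G k *\<^sub>v u) $ c"
    have "z * (\<Sum>j<N. \<alpha> (j + 1) / \<alpha> 0 * vec_block m Y j $ c) = ?D * u' $ c / \<alpha> 0"
      unfolding sum_distrib_left sum_distrib_right sum_divide_distrib using c u'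
      by (intro sum.cong) (auto simp: Yj simp del: index_vec_block)
    moreover have "(\<Sum>k=1..N. z ^ k / \<alpha> 0 * (G k *\<^sub>v u) $ c) = ?H / \<alpha> 0"
      by (simp add: sum_divide_distrib)
    ultimately have update: "block_update m N \<alpha> G z Y u (history_part m N \<alpha> G z u) $ c
        = ((G 0 *\<^sub>v u) $ c - ?H - ?D * u' $ c) / \<alpha> 0"
      using c by (simp add: block_update_def history_part_def diff_divide_distrib
          del: index_vec_block index_mult_mat_vec)
    have numerator: "(numerator_mat m N G lam dt *\<^sub>v u) $ c = (G 0 *\<^sub>v u) $ c - ?H"
      unfolding z_def using G u c by (rule numerator_mat_mult_vec)
    \<comment> \<open>Collecting the multiples of \<open>u'\<close> turns the implicit equation into \<open>d u' = \<dots>\<close>.\<close>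
    have "x = (p - b * x) / \<alpha> 0 \<longleftrightarrow> (\<alpha> 0 + b) * x = p" for x p b
      using \<alpha>0 by (auto simp: eq_divide_eq algebra_simps)
    thus ?thesis unfolding update numerator d .
  qed
  have step: "glm_step (glm_A m N \<alpha>) (glm_U m N \<alpha> G) (glm_B m N \<alpha> G) (glm_V m \<alpha> G)
      (\<lambda>Z. - lam \<cdot>\<^sub>v Z) dt X (glm_state m N \<alpha> G lam dt u) (glm_state m N \<alpha> G lam dt u')
      \<longleftrightarrow> X = Y \<and> u' = block_update m N \<alpha> G z Y u (history_part m N \<alpha> G z u)"
    if X: "X \<in> carrier_vec (N * m)" for X
    unfolding state[OF u] state[OF u'] glm_step_iff_geometric_stages[OF N X u h u' h]
      z_def[symmetric] Y_def[symmetric]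
    using history by metis
  have "(\<exists>X \<in> carrier_vec (N * m). glm_step (glm_A m N \<alpha>) (glm_U m N \<alpha> G) (glm_B m N \<alpha> G) (glm_V m \<alpha> G)
      (\<lambda>Z. - lam \<cdot>\<^sub>v Z) dt X (glm_state m N \<alpha> G lam dt u) (glm_state m N \<alpha> G lam dt u'))
      \<longleftrightarrow> u' = block_update m N \<alpha> G z Y u (history_part m N \<alpha> G z u)"
    using step Y by metis
  also have "\<dots> \<longleftrightarrow> (\<forall>c<m. det_poly N \<alpha> lam dt * u' $ c = (numerator_mat m N G lam dt *\<^sub>v u) $ c)"
    using comp u' by (auto simp: vec_eq_iff block_update_def)
  also have "\<dots> \<longleftrightarrow> det_poly N \<alpha> lam dt \<cdot>\<^sub>v u' = numerator_mat m N G lam dt *\<^sub>v u"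
  proof -
    have "dim_row (numerator_mat m N G lam dt) = m"
      by (rule carrier_matD(1)[OF numerator_mat_carrier]) (rule G)
    thus ?thesis using u' by (auto simp: vec_eq_iff simp del: index_mult_mat_vec)
  qed
  finally show ?thesis .
qed

end

section \<open>Equivalence of the two iterations\<close>

theorem theorem4:
  fixes r N :: nat
    and lam dt :: real
    and Ap Am :: "real \<Rightarrow> real \<Rightarrow> real mat"
    and \<alpha> :: "nat \<Rightarrow> real"
    and G :: "nat \<Rightarrow> real mat"
  assumes "r \<ge> 1" and "N \<ge> 1" and "lam > 0" and "dt > 0"
    and "\<And>l t. l > 0 \<Longrightarrow> t > 0 \<Longrightarrow> Ap l t \<in> carrier_mat (r + 1) (r + 1)"
    and "\<And>l t. l > 0 \<Longrightarrow> t > 0 \<Longrightarrow> Am l t \<in> carrier_mat (r + 1) (r + 1)"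
    and "\<And>k. k \<le> N \<Longrightarrow> G k \<in> carrier_mat (r + 1) (r + 1)"
    and "\<alpha> 0 \<noteq> 0"
    and "\<And>l t. l > 0 \<Longrightarrow> t > 0 \<Longrightarrow> det (Ap l t) = det_poly N \<alpha> l t"
    and "\<And>l t. l > 0 \<Longrightarrow> t > 0 \<Longrightarrow> invertible_mat (Ap l t) \<Longrightarrow>
           scheme_mat (Ap l t) (Am l t)
             = (1 / det_poly N \<alpha> l t) \<cdot>\<^sub>m numerator_mat (r + 1) N G l t"
    and "invertible_mat (Ap lam dt)"
  shows "\<forall>u :: nat \<Rightarrow> real vec. (\<forall>n. u n \<in> carrier_vec (r + 1)) \<longrightarrow>
    (let y = (\<lambda>n. glm_state (r + 1) N \<alpha> G lam dt (u n)) in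
      (\<forall>n. y n \<in> carrier_vec (2 * (r + 1)) \<and> vec_first (y n) (r + 1) = u n) \<and>
      ((\<forall>n. u (n + 1) = scheme_mat (Ap lam dt) (Am lam dt) *\<^sub>v u n) \<longleftrightarrow>
       (\<forall>n. \<exists>Y \<in> carrier_vec (N * (r + 1)).
          glm_step (glm_A (r + 1) N \<alpha>) (glm_U (r + 1) N \<alpha> G)
                   (glm_B (r + 1) N \<alpha> G) (glm_V (r + 1) \<alpha> G)
                   (\<lambda>Z. - lam \<cdot>\<^sub>v Z) dt Y (y n) (y (n + 1)))))"
proof (intro allI impI)
  fix u :: "nat \<Rightarrow> real vec"
  assume "\<forall>n. u n \<in> carrier_vec (r + 1)"
  hence u: "u n \<in> carrier_vec (r + 1)" for n by blast
  note G = assms(7)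
  define d where "d = det_poly N \<alpha> lam dt"
  define P where "P = numerator_mat (r + 1) N G lam dt"
  have P: "P \<in> carrier_mat (r + 1) (r + 1)"
    unfolding P_def using G by (rule numerator_mat_carrier)
  have Ap: "Ap lam dt \<in> carrier_mat (r + 1) (r + 1)" using assms by blast
  have d: "d \<noteq> 0"
  proof -
    obtain X where X: "inverts_mat (Ap lam dt) X" "inverts_mat X (Ap lam dt)"
      using assms(11) unfolding invertible_mat_def by blast
    hence AX: "Ap lam dt * X = 1\<^sub>m (r + 1)" and XA: "X * Ap lam dt = 1\<^sub>m (dim_row X)"
      using Ap unfolding inverts_mat_def by auto
    have "X \<in> carrier_mat (r + 1) (r + 1)"
      using arg_cong[OF AX, of dim_col] arg_cong[OF XA, of dim_col] Ap by auto
    hence "det (Ap lam dt) * det X = 1"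
      using det_mult[OF Ap] AX by (metis det_one)
    thus ?thesis using assms unfolding d_def by auto
  qed
  have scheme: "u (n + 1) = scheme_mat (Ap lam dt) (Am lam dt) *\<^sub>v u n
      \<longleftrightarrow> d \<cdot>\<^sub>v u (n + 1) = P *\<^sub>v u n" for n
  proof -
    have "scheme_mat (Ap lam dt) (Am lam dt) *\<^sub>v u n = (1 / d) \<cdot>\<^sub>v (P *\<^sub>v u n)"
      using assms(10)[OF assms(3,4,11)] P u[of n]
      unfolding d_def P_def by (metis smult_mat_mult_vec)
    moreover have "(1 / d) \<cdot>\<^sub>v (d \<cdot>\<^sub>v v) = v" "d \<cdot>\<^sub>v ((1 / d) \<cdot>\<^sub>v v) = v" for v :: "real vec"
      using d by (simp_all add: smult_smult_assoc)
    ultimately show ?thesis by metis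
  qed
  have step: "(\<exists>Y \<in> carrier_vec (N * (r + 1)).
      glm_step (glm_A (r + 1) N \<alpha>) (glm_U (r + 1) N \<alpha> G) (glm_B (r + 1) N \<alpha> G)
        (glm_V (r + 1) \<alpha> G) (\<lambda>Z. - lam \<cdot>\<^sub>v Z) dt Y
        (glm_state (r + 1) N \<alpha> G lam dt (u n)) (glm_state (r + 1) N \<alpha> G lam dt (u (n + 1))))
      \<longleftrightarrow> u (n + 1) = scheme_mat (Ap lam dt) (Am lam dt) *\<^sub>v u n" for n
    unfolding scheme d_def P_def
    by (intro ex_glm_step_iff) (use G assms(2,8) u in simp_all)
  have state: "glm_state (r + 1) N \<alpha> G lam dt (u n) \<in> carrier_vec (2 * (r + 1))
      \<and> vec_first (glm_state (r + 1) N \<alpha> G lam dt (u n)) (r + 1) = u n" for n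
  proof -
    let ?h = "history_part (r + 1) N \<alpha> G (lam * dt\<^sup>2) (u n)"
    have h: "?h \<in> carrier_vec (r + 1)" by (simp add: history_part_def)
    have split: "glm_state (r + 1) N \<alpha> G lam dt (u n) = u n @\<^sub>v ?h"
      using G u[of n] by (rule glm_state_eq)
    have "u n @\<^sub>v ?h \<in> carrier_vec (2 * (r + 1))"
      unfolding mult_2 using u[of n] h by (rule append_carrier_vec)
    moreover have "vec_first (u n @\<^sub>v ?h) (r + 1) = u n"
      using carrier_vecD[OF u[of n]] carrier_vecD[OF h]
      unfolding vec_first_def by (intro eq_vecI) simp_all
    ultimately show ?thesis unfolding split ..
  qed
  show "let y = (\<lambda>n. glm_state (r + 1) N \<alpha> G lam dt (u n)) in
      (\<forall>n. y n \<in> carrier_vec (2 * (r + 1)) \<and> vec_first (y n) (r + 1) = u n) \<and>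
      ((\<forall>n. u (n + 1) = scheme_mat (Ap lam dt) (Am lam dt) *\<^sub>v u n) \<longleftrightarrow>
       (\<forall>n. \<exists>Y \<in> carrier_vec (N * (r + 1)).
          glm_step (glm_A (r + 1) N \<alpha>) (glm_U (r + 1) N \<alpha> G)
                   (glm_B (r + 1) N \<alpha> G) (glm_V (r + 1) \<alpha> G)
                   (\<lambda>Z. - lam \<cdot>\<^sub>v Z) dt Y (y n) (y (n + 1))))"
    unfolding Let_def step using state by blast
qed

end
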